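(* For $n\in\mathbb{N}_{\ge 1}$ let $\mu_3$, $\nu_{3,n}=\mu_3P_{\frac{\pi}{2n}}$ and $\mu_3P_0$ be the probability measures on $\mathbb{R}^2$ defined in the context. Then $\lim_{n\to\infty}\mathcal{W}_1(\nu_{3,n},\mu_3P_0)=0$. Moreover, we have the following: (i) Let $c_1(x,y):=\|y-x\|$ for all $x,y\in\mathbb{R}^2$ and $\pi_n:=\mu_3(\mathsf{Id},P_{\frac{\pi}{2n}})$ for all $n\in\mathbb{N}_{\ge1}$. For every $n \in \mathbb{N}_{\ge 1}$, the martingale coupling $\pi_n$ is a minimizer of the martingale optimal transport problem between $\mu_3$ and $\nu_{3,n}$ with respect to $c_1$. Moreover, $(\pi_n)_{n}$ is weakly convergent, but its limit is not an optimizer of the martingale optimal transport problem with respect to $c_1$ between its marginals $\mu_3$ and $\mu_3P_0$. (ii) With $c_1$ as in (i), $$\lim_{n\to\infty}V^M_{c_1}(\mu_3,\nu_{3,n})=1>V^M_{c_1}(\mu_3,\mu_3P_0).$$ (iii) The set $\Pi_M(\mu_3,\mu_3P_0)\setminus\{\mu_3(\mathsf{Id},P_0)\}$ is non-empty, and no element of this set is the weak limit of a sequence $(\pi_n)_{n}$ of martingale couplings $\pi_n\in\Pi_M(\mu_3,\nu_{3,n})$.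
   Context: $\|\cdot\|$ is the Euclidean norm. $\mathcal{P}_1(\mathbb{R}^d)$ is the set of probability measures on $\mathbb{R}^d$ with finite first moment. For $\mu,\nu\in\mathcal{P}_1(\mathbb{R}^d)$, $\Pi(\mu,\nu)$ is the set of couplings, i.e. probability measures on $\mathbb{R}^d\times\mathbb{R}^d$ with first marginal $\mu$ and second marginal $\nu$, and $\mathcal{W}_1(\mu,\nu)=\inf_{\pi\in\Pi(\mu,\nu)}\int\|y-x\|\,\mathrm{d}\pi(x,y)$ is the 1-Wasserstein distance. A coupling $\pi\in\Pi(\mu,\nu)$ is a martingale coupling if it has a disintegration $(\pi_x)_{x\in\mathbb{R}^d}$ with respect to $\mu$ such that $\int_{\mathbb{R}^d} y\,\mathrm{d}\pi_x(y)=x$ for $\mu$-a.e. $x$. $\Pi_M(\mu,\nu)$ denotes the set of all martingale couplings between $\mu$ and $\nu$. The martingale optimal transport problem between $\mu$ and $\nu$ (with $\mu$ smaller than $\nu$ in convex order) with respect to a cost function $c:\mathbb{R}^d\times\mathbb{R}^d\to\mathbb{R}$ is to minimize $\int c\,\mathrm{d}\pi$ over $\pi\in\Pi_M(\mu,\nu)$; its value is $V^M_c(\mu,\nu)=\inf_{\pi\in\Pi_M(\mu,\nu)}\int c(x,y)\,\mathrm{d}\pi(x,y)$. For $\theta\in[0,\frac{\pi}{2}]$, $P_\theta$ is the probability kernel on $\mathbb{R}^2$ given by $$P_\theta\big((x_1,x_2),\cdot\big)=\tfrac12\left(\delta_{(x_1,x_2)+(\cos\theta,\sin\theta)}+\delta_{(x_1,x_2)-(\cos\theta,\sin\theta)}\right).$$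 For a probability measure $\mu$ on $\mathbb{R}^2$, $\mu P_\theta$ denotes the measure $\int P_\theta(x,\cdot)\,\mathrm{d}\mu(x)$ on $\mathbb{R}^2$, and $\mu(\mathsf{Id},P_\theta)$ denotes the measure on $\mathbb{R}^2\times\mathbb{R}^2$ given by $\mathrm{d}\mu(x)\,P_\theta(x,\mathrm{d}y)$, i.e. the coupling of $\mu$ and $\mu P_\theta$ with disintegration $x\mapsto P_\theta(x,\cdot)$. For $m,n\in\mathbb{N}_{\ge1}$: $\mu_m:=\sum_{i=1}^m\frac1m\delta_{(i,0)}$ and $\nu_{m,n}:=\mu_mP_{\frac{\pi}{2n}}$, probability measures on $\mathbb{R}^2$. One has $\mu_m\le_c\nu_{m,n}$ in convex order. *)

theory Defs
  imports "HOL-Probability.Probability"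
begin

text \<open>
  A Borel probability measure on a topological space is an element of
  \<open>space (prob_algebra borel)\<close>, and a probability kernel is a measurable map into
  \<open>prob_algebra borel\<close>. For second countable spaces \<open>borel\<close> on a product type coincides
  with the product sigma-algebra (\<open>borel_prod\<close>).
\<close>

section \<open>Kernels and couplings\<close>

text \<open>\<open>\<mu> K = \<integral> K x d\<mu>(x)\<close>.\<close>
definition kernel_image :: "'a::euclidean_space measure \<Rightarrow> ('a \<Rightarrow> 'a measure) \<Rightarrow> 'a measure"
  where "kernel_image \<mu> K = bind \<mu> K"

text \<open>\<open>\<mu>(Id, K)\<close>, i.e. \<open>d\<mu>(x) K(x, dy)\<close>.\<close>
definition kernel_coupling ::
    "'a::euclidean_space measure \<Rightarrow> ('a \<Rightarrow> 'a measure) \<Rightarrow> ('a \<times> 'a) measure"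
  where "kernel_coupling \<mu> K = bind \<mu> (\<lambda>x. distr (K x) borel (\<lambda>y. (x, y)))"

definition couplings ::
    "'a::euclidean_space measure \<Rightarrow> 'a measure \<Rightarrow> ('a \<times> 'a) measure set"
  where "couplings \<mu> \<nu> =
    {\<pi> \<in> space (prob_algebra borel). distr \<pi> borel fst = \<mu> \<and> distr \<pi> borel snd = \<nu>}"

definition is_disintegration ::
    "('a::euclidean_space \<times> 'a) measure \<Rightarrow> 'a measure \<Rightarrow> ('a \<Rightarrow> 'a measure) \<Rightarrow> bool"
  where "is_disintegration \<pi> \<mu> K \<longleftrightarrow>
    K \<in> borel \<rightarrow>\<^sub>M prob_algebra borel \<and> \<pi> = kernel_coupling \<mu> K"

text \<open>
  \<open>has_bochner_integral\<close> contains the integrability of the identity under \<open>K x\<close>; the bare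
  Bochner integral is \<open>0\<close> for non-integrable functions.
\<close>
definition martingale_couplings ::
    "'a::euclidean_space measure \<Rightarrow> 'a measure \<Rightarrow> ('a \<times> 'a) measure set"
  where "martingale_couplings \<mu> \<nu> =
    {\<pi> \<in> couplings \<mu> \<nu>. \<exists>K. is_disintegration \<pi> \<mu> K \<and>
       (AE x in \<mu>. has_bochner_integral (K x) (\<lambda>y. y) x)}"

section \<open>Transport costs\<close>

text \<open>
  The integral of a signed cost is taken in the extended reals, as the difference of the integrals
  of its positive and negative parts, so that non-integrable costs do not get the value \<open>0\<close>.
  On \<^typ>\<open>ereal\<close> one has \<open>\<infinity> - \<infinity> = \<infinity>\<close>: a coupling for which the integral is undefined
  does not lower an infimum. The infimum over the empty set is \<open>\<infinity>\<close>.
\<close>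
definition transport_cost ::
    "('a::euclidean_space \<Rightarrow> 'a \<Rightarrow> real) \<Rightarrow> ('a \<times> 'a) measure \<Rightarrow> ereal"
  where "transport_cost c \<pi> =
    enn2ereal (\<integral>\<^sup>+ (x, y). ennreal (c x y) \<partial>\<pi>) - enn2ereal (\<integral>\<^sup>+ (x, y). ennreal (- c x y) \<partial>\<pi>)"

definition dist_cost :: "'a::euclidean_space \<Rightarrow> 'a \<Rightarrow> real"
  where "dist_cost x y = norm (y - x)"

definition W1 :: "'a::euclidean_space measure \<Rightarrow> 'a measure \<Rightarrow> ereal"
  where "W1 \<mu> \<nu> = (INF \<pi>\<in>couplings \<mu> \<nu>. transport_cost dist_cost \<pi>)"

definition MOT_value ::
    "('a::euclidean_space \<Rightarrow> 'a \<Rightarrow> real) \<Rightarrow> 'a measure \<Rightarrow> 'a measure \<Rightarrow> ereal"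
  where "MOT_value c \<mu> \<nu> = (INF \<pi>\<in>martingale_couplings \<mu> \<nu>. transport_cost c \<pi>)"

definition MOT_minimizer ::
    "('a::euclidean_space \<Rightarrow> 'a \<Rightarrow> real) \<Rightarrow> 'a measure \<Rightarrow> 'a measure \<Rightarrow> ('a \<times> 'a) measure \<Rightarrow> bool"
  where "MOT_minimizer c \<mu> \<nu> \<pi> \<longleftrightarrow>
    \<pi> \<in> martingale_couplings \<mu> \<nu> \<and>
    (\<forall>\<pi>'\<in>martingale_couplings \<mu> \<nu>. transport_cost c \<pi> \<le> transport_cost c \<pi>')"

section \<open>Weak convergence\<close>

text \<open>
  The library's \<^const>\<open>weak_conv_m\<close> is restricted to measures on the real line. The measures
  only need to be Borel probability measures from some index on, so that a sequence indexed by
  the positive integers can be given an arbitrary value at index \<open>0\<close>.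
\<close>
definition weakly_converges ::
    "(nat \<Rightarrow> 'b::topological_space measure) \<Rightarrow> 'b measure \<Rightarrow> bool"
  where "weakly_converges M N \<longleftrightarrow>
    (\<forall>\<^sub>F n in sequentially. M n \<in> space (prob_algebra borel)) \<and>
    N \<in> space (prob_algebra borel) \<and>
    (\<forall>f :: 'b \<Rightarrow> real. continuous_on UNIV f \<longrightarrow> bounded (range f) \<longrightarrow>
       (\<lambda>n. \<integral>z. f z \<partial>M n) \<longlonglongrightarrow> (\<integral>z. f z \<partial>N))"

section \<open>The measures of the example\<close>

text \<open>The finite sum \<open>\<Sum>i\<in>I. w i \<delta>\<^bsub>p i\<^esub>\<close> as a Borel measure.\<close>
definition dirac_sum :: "'i set \<Rightarrow> ('i \<Rightarrow> real) \<Rightarrow> ('i \<Rightarrow> 'b::topological_space) \<Rightarrow> 'b measure"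
  where "dirac_sum I w p =
    measure_of UNIV (sets borel) (\<lambda>A. \<Sum>i\<in>I. ennreal (w i) * emeasure (return borel (p i)) A)"

lemma sets_dirac_sum [simp, measurable_cong]: "sets (dirac_sum I w p) = sets borel"
  and space_dirac_sum [simp]: "space (dirac_sum I w p) = UNIV"
  unfolding dirac_sum_def
  by (metis sets.sets_measure_of_eq space_borel, simp add: space_measure_of_conv)

text \<open>The set function above is countably additive, so \<^const>\<open>measure_of\<close> does not degenerate.\<close>
lemma emeasure_dirac_sum:
  fixes p :: "'i \<Rightarrow> 'b::topological_space"
  assumes "A \<in> sets borel"
  shows "emeasure (dirac_sum I w p) A = (\<Sum>i\<in>I. ennreal (w i) * indicator A (p i))"
proof -
  let ?f = "\<lambda>A :: 'b set. \<Sum>i\<in>I. ennreal (w i) * emeasure (return borel (p i)) A"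
  have "countably_additive (sets borel) ?f"
  proof (rule countably_additiveI)
    fix B :: "nat \<Rightarrow> 'b set"
    assume B: "range B \<subseteq> sets borel" "disjoint_family B" "(\<Union>i. B i) \<in> sets borel"
    have "(\<Sum>n. ?f (B n)) = (\<Sum>i\<in>I. \<Sum>n. ennreal (w i) * emeasure (return borel (p i)) (B n))"
      by (rule suminf_sum) auto
    also have "\<dots> = ?f (\<Union>i. B i)"
      using B by (intro sum.cong refl) (simp add: suminf_indicator)
    finally show "(\<Sum>n. ?f (B n)) = ?f (\<Union>i. B i)" .
  qed
  then have "emeasure (dirac_sum I w p) A = ?f A"
    by (intro emeasure_measure_of[OF dirac_sum_def]) (auto simp: assms positive_def)
  then show ?thesis
    using assms by simp
qed

definition P_kernel :: "real \<Rightarrow> real^2 \<Rightarrow> (real^2) measure"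
  where "P_kernel \<theta> x = dirac_sum {1, -1 :: real} (\<lambda>_. 1/2) (\<lambda>s. x + s *\<^sub>R vector [cos \<theta>, sin \<theta>])"

definition mu :: "nat \<Rightarrow> (real^2) measure"
  where "mu m = dirac_sum {1..m} (\<lambda>_. 1 / real m) (\<lambda>i. vector [real i, 0])"

definition nu :: "nat \<Rightarrow> nat \<Rightarrow> (real^2) measure"
  where "nu m n = kernel_image (mu m) (P_kernel (pi / (2 * real n)))"

end

theory Submission
  imports Defs
begin

text \<open>
  The marginals \<open>\<nu>\<^sub>n\<close> converge because each atom \<open>x \<plusminus> (cos \<theta>, sin \<theta>)\<close> moves continuously with \<open>\<theta>\<close>, but
  the martingale couplings are far more rigid for \<open>\<theta> > 0\<close> than for \<open>\<theta> = 0\<close>. In a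
  martingale coupling the mean squared increment in a fixed direction equals the growth of the
  second moment in that direction (\<open>martingale_kernel_preserves_component\<close>). The kernel \<open>P\<^sub>\<theta>\<close> leaves the component
  perpendicular to \<open>(cos \<theta>, sin \<theta>)\<close> unchanged, so any martingale coupling of \<open>\<mu>\<^sub>m\<close> and \<open>\<mu>\<^sub>m P\<^sub>\<theta>\<close>
  moves mass only along lines parallel to \<open>(cos \<theta>, sin \<theta>)\<close>. When \<open>sin \<theta> \<noteq> 0\<close> these lines separate the
  atoms of \<open>\<mu>\<^sub>m\<close>, and \<open>\<mu>\<^sub>m(Id, P\<^sub>\<theta>)\<close> is the only martingale coupling
  (\<open>martingale_coupling_P_kernel_unique\<close>). In particular it is optimal, with cost \<open>1\<close>.

  For \<open>\<theta> = 0\<close> everything lies on the axis, the constraint disappears, and mass from different atoms can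
  be exchanged: the coupling \<open>dilation_coupling\<close> keeps the middle atom and half of the mass of
  each outer atom in place and costs only \<open>1/2\<close>. As \<open>\<pi>\<^sub>n\<close> is the only candidate for each \<open>n\<close> and converges to
  \<open>\<mu>\<^sub>3(Id, P\<^sub>0)\<close>, the limit has cost \<open>1\<close> and is not optimal, the values do not converge to the value of the limit
  problem, and by uniqueness of weak limits (\<open>weakly_converges_unique\<close>) no other martingale
  coupling of the limit marginals can be approximated.
\<close>

section \<open>Finite sums of Dirac measures\<close>

text \<open>
  Pushing forward a weighted counting measure on the index set reduces integrals and images of
  finite Dirac sums to finite sums.
\<close>
lemma dirac_sum_eq_distr:
  fixes p :: "'i \<Rightarrow> 'b::topological_space"
  assumes "finite I"
  shows "dirac_sum I w p = distr (point_measure I (\<lambda>i. ennreal (w i))) borel p"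
proof (rule measure_eqI)
  fix A assume "A \<in> sets (dirac_sum I w p)"
  then have A: "A \<in> sets borel" by simp
  have "emeasure (distr (point_measure I (\<lambda>i. ennreal (w i))) borel p) A
      = (\<Sum>i\<in>p -` A \<inter> I. ennreal (w i))"
    using A assms
    by (subst emeasure_distr) (auto simp: space_point_measure intro: emeasure_point_measure_finite)
  also have "\<dots> = (\<Sum>i\<in>I. ennreal (w i) * indicator A (p i))"
    using assms by (intro sum.mono_neutral_cong_left) (auto simp: indicator_def)
  finally show "emeasure (dirac_sum I w p) A
      = emeasure (distr (point_measure I (\<lambda>i. ennreal (w i))) borel p) A"
    using A by (simp add: emeasure_dirac_sum)
qed simp

lemma distr_dirac_sum:
  assumes "finite I" and f: "f \<in> borel \<rightarrow>\<^sub>M borel"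
  shows "distr (dirac_sum I w p) borel f = dirac_sum I w (\<lambda>i. f (p i))"
  using assms by (simp add: dirac_sum_eq_distr distr_distr o_def)

lemma nn_integral_dirac_sum:
  assumes "finite I" and f: "f \<in> borel_measurable borel"
  shows "(\<integral>\<^sup>+ x. f x \<partial>dirac_sum I w p) = (\<Sum>i\<in>I. ennreal (w i) * f (p i))"
  using assms by (simp add: dirac_sum_eq_distr nn_integral_distr nn_integral_point_measure_finite)

lemma has_bochner_integral_dirac_sum:
  fixes f :: "'b::topological_space \<Rightarrow> 'c::{banach, second_countable_topology}"
  assumes I: "finite I" and w: "\<And>i. i \<in> I \<Longrightarrow> 0 \<le> w i" and f: "f \<in> borel_measurable borel"
  shows "has_bochner_integral (dirac_sum I w p) f (\<Sum>i\<in>I. w i *\<^sub>R f (p i))"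
proof -
  have "integrable (dirac_sum I w p) f"
    using I f
    by (auto simp: integrable_iff_bounded nn_integral_dirac_sum ennreal_mult_less_top less_top
        measurable_cong_sets[OF sets_dirac_sum refl])
  moreover have "(\<integral>x. f x \<partial>dirac_sum I w p) = (\<Sum>i\<in>I. w i *\<^sub>R f (p i))"
    using I f w
    by (simp add: dirac_sum_eq_distr integral_distr point_measure_def integral_density
        lebesgue_integral_count_space_finite AE_count_space)
  ultimately show ?thesis by (simp add: has_bochner_integral_iff)
qed

lemma AE_dirac_sumD:
  assumes "finite I" "\<And>i. i \<in> I \<Longrightarrow> 0 < w i" and "AE x in dirac_sum I w p. P x" and i: "i \<in> I"
  shows "P (p i)"
proof (rule ccontr)
  assume nP: "\<not> P (p i)"
  obtain N where N: "{x \<in> space (dirac_sum I w p). \<not> P x} \<subseteq> N" "emeasure (dirac_sum I w p) N = 0"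
      "N \<in> sets (dirac_sum I w p)"
    using assms(3) by (rule AE_E)
  then have "(\<Sum>i\<in>I. ennreal (w i) * indicator N (p i)) = 0"
    using emeasure_dirac_sum[of N I w p] by simp
  then have "\<forall>i\<in>I. ennreal (w i) * indicator N (p i) = 0"
    by (simp only: sum_eq_0_iff[OF assms(1)])
  with i have "ennreal (w i) * indicator N (p i) = 0"
    by (rule bspec[rotated])
  then show False using nP N(1) assms(2)[OF i] by (auto simp: indicator_def)
qed

lemma AE_dirac_sum_mem:
  fixes p :: "'i \<Rightarrow> 'b::t1_space"
  assumes "finite I"
  shows "AE x in dirac_sum I w p. x \<in> p ` I"
proof (rule AE_I)
  have "- p ` I \<in> sets borel"
    using assms by (intro borel_open open_Compl finite_imp_closed finite_imageI)
  then show "emeasure (dirac_sum I w p) (- p ` I) = 0" "- p ` I \<in> sets (dirac_sum I w p)"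
    by (simp_all add: emeasure_dirac_sum)
qed auto

lemma prob_space_dirac_sum:
  assumes "finite I" "\<And>i. i \<in> I \<Longrightarrow> 0 \<le> w i" "(\<Sum>i\<in>I. w i) = 1"
  shows "prob_space (dirac_sum I w p)"
  using assms by (intro prob_spaceI) (simp add: emeasure_dirac_sum sum_ennreal)

lemma dirac_sum_in_prob_algebra:
  assumes "finite I" "\<And>i. i \<in> I \<Longrightarrow> 0 \<le> w i" "(\<Sum>i\<in>I. w i) = 1"
  shows "dirac_sum I w p \<in> space (prob_algebra borel)"
  using prob_space_dirac_sum[OF assms] by (simp add: space_prob_algebra)

lemma measurable_dirac_sum:
  fixes q :: "'a \<Rightarrow> 'j \<Rightarrow> 'b::topological_space"
  assumes "finite J" "\<And>j. j \<in> J \<Longrightarrow> 0 \<le> v j" "(\<Sum>j\<in>J. v j) = 1"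
    and q: "\<And>j. j \<in> J \<Longrightarrow> (\<lambda>x. q x j) \<in> borel_measurable M"
  shows "(\<lambda>x. dirac_sum J v (q x)) \<in> M \<rightarrow>\<^sub>M prob_algebra borel"
proof (intro measurable_prob_algebraI measurable_subprob_algebra)
  fix A :: "'b set" assume A: "A \<in> sets borel"
  show "(\<lambda>x. emeasure (dirac_sum J v (q x)) A) \<in> borel_measurable M"
    unfolding emeasure_dirac_sum[OF A]
    by (intro borel_measurable_sum borel_measurable_times_ennreal borel_measurable_const
        measurable_compose[OF q borel_measurable_indicator] A)
qed (auto intro!: prob_space_dirac_sum prob_space_imp_subprob_space assms)

text \<open>
  Kernels that move \<open>x\<close> to \<open>q x j\<close> with a weight \<open>v j\<close> independent of \<open>x\<close> keep finite Dirac
  sums finite: the pairs (starting atom, move) index the atoms of the result. Both \<open>P\<^sub>\<theta>\<close> and the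
  competing kernel of the example have this form.
\<close>
lemma bind_dirac_sum:
  assumes I: "finite I" "\<And>i. i \<in> I \<Longrightarrow> 0 \<le> w i"
    and J: "finite J" "\<And>j. j \<in> J \<Longrightarrow> 0 \<le> v j" "(\<Sum>j\<in>J. v j) = 1"
    and q: "\<And>j. j \<in> J \<Longrightarrow> (\<lambda>x. q x j) \<in> borel_measurable borel"
  shows "dirac_sum I w p \<bind> (\<lambda>x. dirac_sum J v (q x))
    = dirac_sum (I \<times> J) (\<lambda>(i, j). w i * v j) (\<lambda>(i, j). q (p i) j)"
proof (rule measure_eqI)
  have K: "(\<lambda>x. dirac_sum J v (q x)) \<in> dirac_sum I w p \<rightarrow>\<^sub>M subprob_algebra borel"
    using measurable_prob_algebraD[OF measurable_dirac_sum[where J=J and v=v and q=q, OF J q]]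
    by (simp add: measurable_cong_sets[OF sets_dirac_sum refl])
  show s: "sets (dirac_sum I w p \<bind> (\<lambda>x. dirac_sum J v (q x)))
     = sets (dirac_sum (I \<times> J) (\<lambda>(i, j). w i * v j) (\<lambda>(i, j). q (p i) j))"
    by (subst sets_bind[where N=borel]) auto
  fix A assume "A \<in> sets (dirac_sum I w p \<bind> (\<lambda>x. dirac_sum J v (q x)))"
  then have A: "A \<in> sets borel" using s by simp
  have m: "(\<lambda>x. emeasure (dirac_sum J v (q x)) A) \<in> borel_measurable borel"
    unfolding emeasure_dirac_sum[OF A]
    by (intro borel_measurable_sum borel_measurable_times_ennreal borel_measurable_const
        measurable_compose[OF q borel_measurable_indicator] A)
  have "emeasure (dirac_sum I w p \<bind> (\<lambda>x. dirac_sum J v (q x))) A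
     = (\<Sum>i\<in>I. ennreal (w i) * (\<Sum>j\<in>J. ennreal (v j) * indicator A (q (p i) j)))"
    using I m by (subst emeasure_bind[OF _ K A])
      (simp_all add: nn_integral_dirac_sum emeasure_dirac_sum[OF A])
  also have "\<dots> = (\<Sum>i\<in>I. \<Sum>j\<in>J. ennreal (w i * v j) * indicator A (q (p i) j))"
    unfolding sum_distrib_left
    by (intro sum.cong refl) (simp only: ennreal_mult I J mult.assoc)
  also have "\<dots> = emeasure (dirac_sum (I \<times> J) (\<lambda>(i, j). w i * v j) (\<lambda>(i, j). q (p i) j)) A"
    by (simp only: emeasure_dirac_sum[OF A] sum.cartesian_product split_def)
  finally show "emeasure (dirac_sum I w p \<bind> (\<lambda>x. dirac_sum J v (q x))) A = \<dots>" .
qed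

lemma kernel_image_dirac_sum:
  assumes "finite I" "\<And>i. i \<in> I \<Longrightarrow> 0 \<le> w i"
    and "finite J" "\<And>j. j \<in> J \<Longrightarrow> 0 \<le> v j" "(\<Sum>j\<in>J. v j) = 1"
    and "\<And>j. j \<in> J \<Longrightarrow> (\<lambda>x. q x j) \<in> borel_measurable borel"
  shows "kernel_image (dirac_sum I w p) (\<lambda>x. dirac_sum J v (q x))
    = dirac_sum (I \<times> J) (\<lambda>(i, j). w i * v j) (\<lambda>(i, j). q (p i) j)"
  unfolding kernel_image_def using assms by (rule bind_dirac_sum)

lemma borel_measurable_Pair_const [measurable]:
  "Pair (x :: 'a::euclidean_space) \<in> (borel :: 'a measure) \<rightarrow>\<^sub>M borel"
  by (intro borel_measurable_continuous_onI continuous_intros)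

lemma borel_measurable_fst:
  "fst \<in> (borel :: ('a::topological_space \<times> 'b::topological_space) measure) \<rightarrow>\<^sub>M borel"
  by (intro borel_measurable_continuous_onI continuous_on_fst continuous_on_id)

lemma borel_measurable_snd:
  "snd \<in> (borel :: ('a::topological_space \<times> 'b::topological_space) measure) \<rightarrow>\<^sub>M borel"
  by (intro borel_measurable_continuous_onI continuous_on_snd continuous_on_id)

lemma kernel_coupling_dirac_sum:
  assumes "finite I" "\<And>i. i \<in> I \<Longrightarrow> 0 \<le> w i"
    and J: "finite J" "\<And>j. j \<in> J \<Longrightarrow> 0 \<le> v j" "(\<Sum>j\<in>J. v j) = 1"
    and q: "\<And>j. j \<in> J \<Longrightarrow> (\<lambda>x. q x j) \<in> borel_measurable borel"
  shows "kernel_coupling (dirac_sum I w p) (\<lambda>x. dirac_sum J v (q x))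
    = dirac_sum (I \<times> J) (\<lambda>(i, j). w i * v j) (\<lambda>(i, j). (p i, q (p i) j))"
  unfolding kernel_coupling_def distr_dirac_sum[OF J(1) borel_measurable_Pair_const]
  using assms by (intro bind_dirac_sum) auto

lemma dirac_sum_martingale_coupling:
  fixes q :: "'a::euclidean_space \<Rightarrow> 'j \<Rightarrow> 'a" and p :: "'i \<Rightarrow> 'a"
  assumes I: "finite I" "\<And>i. i \<in> I \<Longrightarrow> 0 \<le> w i" "(\<Sum>i\<in>I. w i) = 1"
    and J: "finite J" "\<And>j. j \<in> J \<Longrightarrow> 0 \<le> v j" "(\<Sum>j\<in>J. v j) = 1"
    and q: "\<And>j. j \<in> J \<Longrightarrow> (\<lambda>x. q x j) \<in> borel_measurable borel"
    and mean: "\<And>x. (\<Sum>j\<in>J. v j *\<^sub>R q x j) = x"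
  defines "\<mu> \<equiv> dirac_sum I w p" and "K \<equiv> \<lambda>x. dirac_sum J v (q x)"
  shows "kernel_coupling \<mu> K \<in> martingale_couplings \<mu> (kernel_image \<mu> K)"
proof -
  have kc: "kernel_coupling \<mu> K
      = dirac_sum (I \<times> J) (\<lambda>(i, j). w i * v j) (\<lambda>(i, j). (p i, q (p i) j))"
    unfolding \<mu>_def K_def using I J q by (intro kernel_coupling_dirac_sum)
  have ki: "kernel_image \<mu> K = dirac_sum (I \<times> J) (\<lambda>(i, j). w i * v j) (\<lambda>(i, j). q (p i) j)"
    unfolding \<mu>_def K_def using I J q by (intro kernel_image_dirac_sum)
  have "(\<Sum>(i, j)\<in>I \<times> J. w i * v j) = 1"
    by (simp add: sum.cartesian_product[symmetric] sum_distrib_left[symmetric] J I)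
  then have prob: "kernel_coupling \<mu> K \<in> space (prob_algebra borel)"
    unfolding kc using I J by (intro dirac_sum_in_prob_algebra) auto
  have "distr (kernel_coupling \<mu> K) borel fst
      = dirac_sum (I \<times> J) (\<lambda>(i, j). w i * v j) (\<lambda>(i, j). p i)"
    unfolding kc using I J
    by (simp add: distr_dirac_sum[OF _ borel_measurable_fst] split_def)
  also have "\<dots> = \<mu>"
    unfolding \<mu>_def
  proof (rule measure_eqI)
    fix A assume "A \<in> sets (dirac_sum (I \<times> J) (\<lambda>(i, j). w i * v j) (\<lambda>(i, j). p i))"
    then have A: "A \<in> sets borel" by simp
    have "(\<Sum>j\<in>J. ennreal (w i * v j) * indicator A (p i)) = ennreal (w i) * indicator A (p i)"
      if "i \<in> I" for i
      using I(2)[OF that] J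
      by (simp add: sum_distrib_right[symmetric] sum_distrib_left[symmetric] sum_ennreal)
    then have "(\<Sum>i\<in>I. \<Sum>j\<in>J. ennreal (w i * v j) * indicator A (p i))
        = (\<Sum>i\<in>I. ennreal (w i) * indicator A (p i))"
      by (rule sum.cong[OF refl])
    then show "emeasure (dirac_sum (I \<times> J) (\<lambda>(i, j). w i * v j) (\<lambda>(i, j). p i)) A
        = emeasure (dirac_sum I w p) A"
      by (simp only: emeasure_dirac_sum[OF A] sum.cartesian_product split_def)
  qed simp
  finally have fst: "distr (kernel_coupling \<mu> K) borel fst = \<mu>" .
  have snd: "distr (kernel_coupling \<mu> K) borel snd = kernel_image \<mu> K"
    unfolding kc ki using I J
    by (simp add: distr_dirac_sum[OF _ borel_measurable_snd] split_def)
  have "K \<in> borel \<rightarrow>\<^sub>M prob_algebra borel"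
    unfolding K_def using J q by (intro measurable_dirac_sum)
  moreover have "has_bochner_integral (K x) (\<lambda>y. y) x" for x
    using has_bochner_integral_dirac_sum[where I=J and w=v and p="q x" and f="\<lambda>y. y"] J
    by (simp add: K_def mean)
  ultimately show ?thesis
    using prob fst snd
    by (auto simp: martingale_couplings_def couplings_def is_disintegration_def)
qed

section \<open>Transport costs\<close>

lemma transport_cost_dist:
  "transport_cost dist_cost \<pi> = enn2ereal (\<integral>\<^sup>+ z. ennreal (norm (snd z - fst z)) \<partial>\<pi>)"
  by (simp add: transport_cost_def dist_cost_def split_def ennreal_neg zero_ennreal.rep_eq)

lemma transport_cost_dist_dirac_sum:
  assumes "finite I" "\<And>i. i \<in> I \<Longrightarrow> 0 \<le> w i"
  shows "transport_cost dist_cost (dirac_sum I w p)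
    = ereal (\<Sum>i\<in>I. w i * norm (snd (p i) - fst (p i)))"
proof -
  have "(\<integral>\<^sup>+ z. ennreal (norm (snd z - fst z)) \<partial>dirac_sum I w p)
      = ennreal (\<Sum>i\<in>I. w i * norm (snd (p i) - fst (p i)))"
    using assms
    by (subst nn_integral_dirac_sum)
       (auto simp: ennreal_mult sum_ennreal[symmetric]
         intro!: borel_measurable_continuous_onI continuous_intros sum.cong)
  then show ?thesis
    using assms by (simp add: transport_cost_dist enn2ereal_ennreal sum_nonneg)
qed

lemma W1_nonneg: "0 \<le> W1 \<mu> \<nu>"
  unfolding W1_def by (intro INF_greatest) (simp add: transport_cost_dist)

text \<open>
  Atoms with the same index are transported onto each other.
\<close>
lemma W1_dirac_sum_le:
  fixes p q :: "'i \<Rightarrow> 'a::euclidean_space"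
  assumes I: "finite I" "\<And>i. i \<in> I \<Longrightarrow> 0 \<le> w i" "(\<Sum>i\<in>I. w i) = 1"
  shows "W1 (dirac_sum I w p) (dirac_sum I w q) \<le> ereal (\<Sum>i\<in>I. w i * norm (q i - p i))"
proof -
  let ?\<pi> = "dirac_sum I w (\<lambda>i. (p i, q i))"
  have "?\<pi> \<in> couplings (dirac_sum I w p) (dirac_sum I w q)"
    using I unfolding couplings_def
    by (simp add: dirac_sum_in_prob_algebra distr_dirac_sum[OF _ borel_measurable_fst]
        distr_dirac_sum[OF _ borel_measurable_snd])
  then have "W1 (dirac_sum I w p) (dirac_sum I w q) \<le> transport_cost dist_cost ?\<pi>"
    unfolding W1_def by (rule INF_lower)
  then show ?thesis
    using I by (simp add: transport_cost_dist_dirac_sum)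
qed

section \<open>Uniqueness of weak limits\<close>

text \<open>
  The indicator of an open set \<open>U\<close> is the pointwise increasing limit of the continuous functions
  \<open>min 1 (k * infdist x (- U))\<close>, so integrals of bounded continuous functions determine the measure of
  open sets, which form an intersection-stable generator.
\<close>
lemma prob_measure_eqI_bounded_continuous:
  fixes M N :: "'a::metric_space measure"
  assumes M: "M \<in> space (prob_algebra borel)" and N: "N \<in> space (prob_algebra borel)"
    and eq: "\<And>f :: 'a \<Rightarrow> real. continuous_on UNIV f \<Longrightarrow> bounded (range f) \<Longrightarrow>
      (\<integral>x. f x \<partial>M) = (\<integral>x. f x \<partial>N)"
  shows "M = N"
proof -
  interpret M: prob_space M using M by (simp add: space_prob_algebra)
  interpret N: prob_space N using N by (simp add: space_prob_algebra)
  have sM: "sets M = sets borel" and sN: "sets N = sets borel"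
    using M N by (auto simp: space_prob_algebra)
  have spM: "space M = UNIV" and spN: "space N = UNIV"
    using sets_eq_imp_space_eq[OF sM] sets_eq_imp_space_eq[OF sN] by auto
  have opn: "emeasure M U = emeasure N U" if U: "open U" for U
    \<comment> \<open>The case \<open>U = UNIV\<close> is separate because \<open>infdist x {} = 0\<close>, not infinity.\<close>
  proof (cases "U = UNIV")
    case True
    then show ?thesis using M.emeasure_space_1 N.emeasure_space_1 by (simp add: spM spN)
  next
    case False
    define f where "f k x = min 1 (real k * infdist x (- U))" for k x
    have cont: "continuous_on UNIV (f k)" for k
      unfolding f_def by (intro continuous_intros)
    have bd: "\<bar>f k x\<bar> \<le> 1" for k x
      unfolding f_def by (auto simp: infdist_nonneg)
    have lim: "(\<lambda>k. f k x) \<longlonglongrightarrow> indicator U x" for x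
    proof (cases "x \<in> U")
      case True
      have "infdist x (- U) > 0"
        using U False True by (intro infdist_pos_not_in_closed) auto
      then have "\<forall>\<^sub>F k in sequentially. f k x = 1"
        by (intro eventually_mono[OF eventually_ge_at_top[of "nat \<lceil>1 / infdist x (- U)\<rceil>"]])
           (auto simp: f_def min_def field_simps nat_le_iff ceiling_le_iff)
      then show ?thesis using True by (simp add: tendsto_eventually)
    next
      case False
      then show ?thesis by (simp add: f_def)
    qed
    have L: "(\<lambda>k. \<integral>x. f k x \<partial>P) \<longlonglongrightarrow> measure P U"
      if "prob_space P" and sP: "sets P = sets borel" for P
    proof -
      interpret prob_space P by fact
      have spP: "space P = UNIV" using sets_eq_imp_space_eq[OF sP] by simp
      have m: "g \<in> borel_measurable P \<longleftrightarrow> g \<in> borel_measurable borel" for g :: "'a \<Rightarrow> real"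
        by (simp add: measurable_cong_sets[OF sP refl])
      have "(\<lambda>k. \<integral>x. f k x \<partial>P) \<longlonglongrightarrow> (\<integral>x. indicator U x \<partial>P)"
        by (rule integral_dominated_convergence[where w="\<lambda>_. 1"])
           (auto simp: m lim bd U intro!: borel_measurable_continuous_onI cont borel_open)
      then show ?thesis by (simp add: spP)
    qed
    have "bounded (range (f k))" for k
      using bd by (auto intro!: boundedI[where B=1])
    then have "(\<integral>x. f k x \<partial>M) = (\<integral>x. f k x \<partial>N)" for k
      using eq cont by blast
    then have "measure M U = measure N U"
      using L[OF M.prob_space_axioms sM] L[OF N.prob_space_axioms sN] LIMSEQ_unique by simp
    then show ?thesis
      by (simp add: M.emeasure_eq_measure N.emeasure_eq_measure)
  qed
  show ?thesis
    by (rule measure_eqI_generator_eq[where E="{U. open U}" and \<Omega>=UNIV and A="\<lambda>_. UNIV"])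
       (auto simp: opn sM sN Int_stable_def borel_def)
qed

lemma weakly_converges_unique:
  fixes P Q :: "'a::metric_space measure"
  assumes P: "weakly_converges M P" and Q: "weakly_converges N Q"
    and MN: "\<forall>\<^sub>F n in sequentially. M n = N n"
  shows "P = Q"
proof (rule prob_measure_eqI_bounded_continuous)
  fix f :: "'a \<Rightarrow> real" assume f: "continuous_on UNIV f" "bounded (range f)"
  have M: "(\<lambda>n. \<integral>z. f z \<partial>M n) \<longlonglongrightarrow> (\<integral>z. f z \<partial>P)"
    and N: "(\<lambda>n. \<integral>z. f z \<partial>N n) \<longlonglongrightarrow> (\<integral>z. f z \<partial>Q)"
    using P Q f by (auto simp: weakly_converges_def)
  have "\<forall>\<^sub>F n in sequentially. (\<integral>z. f z \<partial>M n) = (\<integral>z. f z \<partial>N n)"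
    using MN by eventually_elim simp
  from tendsto_cong[OF this] M have "(\<lambda>n. \<integral>z. f z \<partial>N n) \<longlonglongrightarrow> (\<integral>z. f z \<partial>P)"
    by (rule iffD1)
  then show "(\<integral>z. f z \<partial>P) = (\<integral>z. f z \<partial>Q)"
    using N by (rule LIMSEQ_unique)
qed (use P Q in \<open>auto simp: weakly_converges_def\<close>)

lemma weakly_converges_dirac_sum:
  fixes p :: "nat \<Rightarrow> 'i \<Rightarrow> 'b::topological_space"
  assumes I: "finite I" "\<And>i. i \<in> I \<Longrightarrow> 0 \<le> w i" "(\<Sum>i\<in>I. w i) = 1"
    and p: "\<And>i. i \<in> I \<Longrightarrow> (\<lambda>n. p n i) \<longlonglongrightarrow> q i"
  shows "weakly_converges (\<lambda>n. dirac_sum I w (p n)) (dirac_sum I w q)"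
  unfolding weakly_converges_def
proof (intro conjI allI impI)
  fix f :: "'b \<Rightarrow> real" assume f: "continuous_on UNIV f"
  have "(\<integral>z. f z \<partial>dirac_sum I w r) = (\<Sum>i\<in>I. w i *\<^sub>R f (r i))" for r :: "'i \<Rightarrow> 'b"
    using has_bochner_integral_dirac_sum[OF I(1,2) borel_measurable_continuous_onI[OF f]]
    by (rule has_bochner_integral_integral_eq)
  then show "(\<lambda>n. \<integral>z. f z \<partial>dirac_sum I w (p n)) \<longlonglongrightarrow> (\<integral>z. f z \<partial>dirac_sum I w q)"
    using f by (auto intro!: tendsto_intros p continuous_on_tendsto_compose[OF f])
qed (use I in \<open>auto intro!: always_eventually dirac_sum_in_prob_algebra\<close>)

section \<open>Martingale couplings and second moments\<close>

lemma measurable_distr_Pair: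
  fixes K :: "'a::euclidean_space \<Rightarrow> 'a measure"
  assumes "K \<in> borel \<rightarrow>\<^sub>M prob_algebra borel"
  shows "(\<lambda>x. distr (K x) borel (\<lambda>y. (x, y))) \<in> borel \<rightarrow>\<^sub>M prob_algebra borel"
proof (intro measurable_prob_algebraI)
  fix x :: 'a
  have "K x \<in> space (prob_algebra borel)"
    using measurable_space[OF assms] by simp
  then have "prob_space (K x)" and sK: "sets (K x) = sets borel"
    by (auto simp: space_prob_algebra)
  then show "prob_space (distr (K x) borel (\<lambda>y. (x, y)))"
    using borel_measurable_Pair_const[of x]
    by (intro prob_space.prob_space_distr) (simp_all add: measurable_cong_sets[OF sK refl])
next
  show "(\<lambda>x. distr (K x) borel (\<lambda>y. (x, y))) \<in> borel \<rightarrow>\<^sub>M subprob_algebra borel"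
    by (rule measurable_distr2[where M=borel])
       (auto intro: measurable_prob_algebraD assms simp: borel_prod)
qed

lemma kernel_image_eq_snd_marginal:
  fixes K :: "'a::euclidean_space \<Rightarrow> 'a measure"
  assumes \<mu>: "\<mu> \<in> space (prob_algebra borel)" and K: "K \<in> borel \<rightarrow>\<^sub>M prob_algebra borel"
  shows "distr (kernel_coupling \<mu> K) borel snd = kernel_image \<mu> K"
proof -
  have s: "sets \<mu> = sets borel" and ne: "space \<mu> \<noteq> {}"
    using \<mu> by (auto simp: space_prob_algebra prob_space.not_empty)
  have "distr (distr (K x) borel (\<lambda>y. (x, y))) borel snd = K x" for x
  proof -
    have sK: "sets (K x) = sets borel"
      using measurable_space[OF K, of x] by (simp add: space_prob_algebra)
    have "distr (distr (K x) borel (\<lambda>y. (x, y))) borel snd = distr (K x) borel (\<lambda>y. y)"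
      by (simp add: distr_distr[OF borel_measurable_snd] measurable_cong_sets[OF sK refl] borel_measurable_Pair_const o_def)
    then show ?thesis using sK by (simp add: distr_id2)
  qed
  moreover have "(\<lambda>x. distr (K x) borel (\<lambda>y. (x, y))) \<in> \<mu> \<rightarrow>\<^sub>M subprob_algebra borel"
    using measurable_prob_algebraD[OF measurable_distr_Pair[OF K]]
    by (simp add: measurable_cong_sets[OF s refl])
  ultimately show ?thesis
    unfolding kernel_coupling_def kernel_image_def
    by (subst distr_bind[OF _ ne borel_measurable_snd]) auto
qed

text \<open>
  A martingale has orthogonal increments, so the mean squared increment of the component along
  \<open>u\<close> is the growth of its second moment. If the two marginals have equal second moments in
  that direction, the coupling cannot move mass along \<open>u\<close> at all. At each
  atom the variance of the kernel along \<open>u\<close> vanishes, as the weighted variances add up to zero.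
\<close>
lemma martingale_kernel_preserves_component:
  fixes p :: "'i \<Rightarrow> 'a::euclidean_space" and q :: "'j \<Rightarrow> 'a"
  assumes I: "finite I" "\<And>i. i \<in> I \<Longrightarrow> 0 < w i"
    and J: "finite J" "\<And>j. j \<in> J \<Longrightarrow> 0 \<le> v j"
    and K: "K \<in> borel \<rightarrow>\<^sub>M prob_algebra borel"
    and image: "kernel_image (dirac_sum I w p) K = dirac_sum J v q"
    and mean: "\<And>i. i \<in> I \<Longrightarrow> has_bochner_integral (K (p i)) (\<lambda>y. y) (p i)"
    and moment: "(\<Sum>j\<in>J. v j * (q j \<bullet> u)\<^sup>2) = (\<Sum>i\<in>I. w i * (p i \<bullet> u)\<^sup>2)"
    and i: "i \<in> I"
  shows "AE y in K (p i). y \<in> q ` J \<and> y \<bullet> u = p i \<bullet> u"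
proof -
  have K': "K \<in> dirac_sum I w p \<rightarrow>\<^sub>M subprob_algebra borel"
    using measurable_prob_algebraD[OF K] by (simp add: measurable_cong_sets[OF sets_dirac_sum refl])
  have prob: "prob_space (K x)" and sK: "sets (K x) = sets borel" for x
    using measurable_space[OF K, of x] by (auto simp: space_prob_algebra)
  have meas: "f \<in> borel_measurable (K x) \<longleftrightarrow> f \<in> borel_measurable borel" for f :: "'a \<Rightarrow> real" and x
    by (simp add: measurable_cong_sets[OF sK refl])
  have "q ` J \<in> sets borel"
    using J by (intro borel_closed finite_imp_closed finite_imageI)
  then have supp0: "AE x in dirac_sum I w p. AE y in K x. y \<in> q ` J"
    using AE_dirac_sum_mem[OF J(1), where w=v and p=q] AE_bind[OF K', of "\<lambda>y. y \<in> q ` J"]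
    unfolding image[symmetric] kernel_image_def by (simp add: pred_def)
  have supp: "AE y in K (p k). y \<in> q ` J" if "k \<in> I" for k
    by (rule AE_dirac_sumD[OF I(1) _ supp0 that]) (rule I(2))
  \<comment> \<open>All \<open>K (p k)\<close> are concentrated on the finite set \<open>q ` J\<close>, so second moments exist.\<close>
  obtain B where B: "\<And>y. y \<in> q ` J \<Longrightarrow> norm ((y \<bullet> u)\<^sup>2) \<le> B"
    using finite_imp_bounded[of "(\<lambda>y. (y \<bullet> u)\<^sup>2) ` q ` J"] J(1) unfolding bounded_iff by auto
  have msq: "(\<lambda>y. (y \<bullet> u)\<^sup>2) \<in> borel_measurable borel"
    by measurable
  have int2: "integrable (K (p k)) (\<lambda>y. (y \<bullet> u)\<^sup>2)" if "k \<in> I" for k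
  proof -
    interpret prob_space "K (p k)" by (rule prob)
    have "AE y in K (p k). norm ((y \<bullet> u)\<^sup>2) \<le> B"
      using supp[OF that] by eventually_elim (rule B)
    then show ?thesis
      by (rule integrable_const_bound) (simp add: meas msq)
  qed
  define var where "var k = (\<integral>y. (y \<bullet> u - p k \<bullet> u)\<^sup>2 \<partial>K (p k))" for k
  have int1: "integrable (K (p k)) (\<lambda>y. y \<bullet> u)" "(\<integral>y. y \<bullet> u \<partial>K (p k)) = p k \<bullet> u" if "k \<in> I" for k
    using mean[OF that] by (auto simp: has_bochner_integral_iff)
  have sq: "(y \<bullet> u - p k \<bullet> u)\<^sup>2 = (y \<bullet> u)\<^sup>2 - 2 * (p k \<bullet> u) * (y \<bullet> u) + (p k \<bullet> u)\<^sup>2" for y k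
    by (simp add: power2_eq_square algebra_simps)
  have intv: "integrable (K (p k)) (\<lambda>y. (y \<bullet> u - p k \<bullet> u)\<^sup>2)"
    and var: "var k = (\<integral>y. (y \<bullet> u)\<^sup>2 \<partial>K (p k)) - (p k \<bullet> u)\<^sup>2" if "k \<in> I" for k
  proof -
    interpret prob_space "K (p k)" by (rule prob)
    show "integrable (K (p k)) (\<lambda>y. (y \<bullet> u - p k \<bullet> u)\<^sup>2)"
      unfolding sq using int1[OF that] int2[OF that] by simp
    show "var k = (\<integral>y. (y \<bullet> u)\<^sup>2 \<partial>K (p k)) - (p k \<bullet> u)\<^sup>2"
      unfolding var_def sq using int1[OF that] int2[OF that]
      by (simp add: prob_space power2_eq_square)
  qed
  have "ennreal (\<Sum>k\<in>I. w k * (\<integral>y. (y \<bullet> u)\<^sup>2 \<partial>K (p k)))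
      = (\<Sum>k\<in>I. ennreal (w k) * (\<integral>\<^sup>+y. ennreal ((y \<bullet> u)\<^sup>2) \<partial>K (p k)))"
    using I(2) int2
    by (subst sum_ennreal[symmetric])
       (auto simp: nn_integral_eq_integral ennreal_mult less_imp_le intro!: sum.cong mult_nonneg_nonneg)
  also have "\<dots> = (\<integral>\<^sup>+x. \<integral>\<^sup>+y. ennreal ((y \<bullet> u)\<^sup>2) \<partial>K x \<partial>dirac_sum I w p)"
  proof (rule nn_integral_dirac_sum[OF I(1), symmetric])
    show "(\<lambda>x. \<integral>\<^sup>+y. ennreal ((y \<bullet> u)\<^sup>2) \<partial>K x) \<in> borel_measurable borel"
      by (rule measurable_compose[OF measurable_prob_algebraD[OF K] nn_integral_measurable_subprob_algebra])
         measurable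
  qed
  also have "\<dots> = (\<integral>\<^sup>+y. ennreal ((y \<bullet> u)\<^sup>2) \<partial>dirac_sum J v q)"
    unfolding image[symmetric] kernel_image_def by (rule nn_integral_bind[OF _ K', symmetric]) measurable
  also have "\<dots> = ennreal (\<Sum>j\<in>J. v j * (q j \<bullet> u)\<^sup>2)"
    using J by (subst nn_integral_dirac_sum) (auto simp: ennreal_mult simp flip: sum_ennreal intro!: sum.cong)
  finally have "(\<Sum>k\<in>I. w k * (\<integral>y. (y \<bullet> u)\<^sup>2 \<partial>K (p k))) = (\<Sum>k\<in>I. w k * (p k \<bullet> u)\<^sup>2)"
    unfolding moment using I(2)
    by (subst (asm) ennreal_inj) (auto intro!: sum_nonneg mult_nonneg_nonneg simp: less_imp_le)
  then have "(\<Sum>k\<in>I. w k * var k) = 0"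
    by (simp add: var right_diff_distrib sum_subtractf)
  moreover have "0 \<le> var k" for k
    unfolding var_def by simp
  ultimately have "w i * var i = 0"
    using I i by (subst (asm) sum_nonneg_eq_0_iff) (auto simp: less_imp_le)
  then have "(\<integral>y. (y \<bullet> u - p i \<bullet> u)\<^sup>2 \<partial>K (p i)) = 0"
    using I(2)[OF i] by (simp add: var_def)
  then have "AE y in K (p i). (y \<bullet> u - p i \<bullet> u)\<^sup>2 = 0"
    using integral_nonneg_eq_0_iff_AE[OF intv[OF i]] by simp
  with supp[OF i] show ?thesis by eventually_elim simp
qed

text \<open>
  Two weights adding up to one are determined by the mean. On the two points \<open>a + v\<close> and \<open>a - v\<close> every
  function agrees with an affine function of \<open>y\<close>, and the integral of an affine function is its value
  at the mean.
\<close>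
lemma symmetric_two_point_measure:
  fixes a v :: "'a::euclidean_space"
  assumes M: "M \<in> space (prob_algebra borel)" and v: "v \<noteq> 0"
    and supp: "AE y in M. y = a + v \<or> y = a - v"
    and mean: "has_bochner_integral M (\<lambda>y. y) a"
  shows "M = dirac_sum {1, -1 :: real} (\<lambda>_. 1/2) (\<lambda>s. a + s *\<^sub>R v)"
proof (rule measure_eqI)
  interpret prob_space M using M by (simp add: space_prob_algebra)
  have sM: "sets M = sets borel" using M by (simp add: space_prob_algebra)
  then show "sets M = sets (dirac_sum {1, -1 :: real} (\<lambda>_. 1/2) (\<lambda>s. a + s *\<^sub>R v))" by simp
  fix A assume AM: "A \<in> sets M"
  \<comment> \<open>The affine coordinate that equals \<open>1\<close> at \<open>a + v\<close> and \<open>-1\<close> at \<open>a - v\<close>.\<close>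
  define t where "t = (\<lambda>y. ((y - a) \<bullet> v) / (v \<bullet> v))"
  have int: "integrable M t" and t0: "(\<integral>y. t y \<partial>M) = 0"
    using mean by (auto simp: t_def has_bochner_integral_iff inner_diff_left prob_space)
  define b c :: real where "b = indicator A (a + v)" and "c = indicator A (a - v)"
  have "measure M A = (\<integral>y. indicator A y \<partial>M)"
    using AM by simp
  also have "\<dots> = (\<integral>y. (b + c) / 2 + (b - c) / 2 * t y \<partial>M)"
  proof (rule integral_cong_AE)
    show "AE y in M. indicator A y = (b + c) / 2 + (b - c) / 2 * t y"
      using supp
    proof eventually_elim
      case (elim y)
      have "t y = (if y = a + v then 1 else -1)"
        using elim v by (auto simp: t_def)
      then show ?case
        using elim by (auto simp: b_def c_def field_simps)
    qed
  qed (use AM int in auto)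
  also have "\<dots> = (b + c) / 2"
    using int t0 by (simp add: prob_space)
  finally have prob: "measure M A = (b + c) / 2" .
  have "emeasure (dirac_sum {1, -1 :: real} (\<lambda>_. 1/2) (\<lambda>s. a + s *\<^sub>R v)) A
      = ennreal (1/2) * ennreal b + ennreal (1/2) * ennreal c"
    unfolding emeasure_dirac_sum[OF AM[unfolded sM]]
    by (subst sum.insert) (simp_all add: b_def c_def ennreal_indicator)
  also have "\<dots> = ennreal (1/2 * b) + ennreal (1/2 * c)"
    by (simp only: ennreal_mult b_def c_def indicator_pos_le zero_le_divide_1_iff zero_le_numeral)
  also have "\<dots> = ennreal ((b + c) / 2)"
    by (subst ennreal_plus[symmetric]) (simp_all add: b_def c_def add_divide_distrib del: ennreal_plus)
  finally show "emeasure M A = emeasure (dirac_sum {1, -1 :: real} (\<lambda>_. 1/2) (\<lambda>s. a + s *\<^sub>R v)) A"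
    by (simp add: emeasure_eq_measure prob)
qed

section \<open>Splitting along a line transversal to the axis\<close>

definition dir :: "real \<Rightarrow> real^2"
  where "dir \<theta> = vector [cos \<theta>, sin \<theta>]"

definition site :: "nat \<Rightarrow> real^2"
  where "site i = vector [real i, 0]"

lemma inner_vec2: "(x :: real^2) \<bullet> y = x $ 1 * y $ 1 + x $ 2 * y $ 2"
  by (simp add: inner_vec_def sum_2)

lemma norm_dir [simp]: "norm (dir \<theta>) = 1"
  by (simp add: norm_eq_sqrt_inner inner_vec2 dir_def power2_eq_square[symmetric])

lemma tendsto_dir: "f \<longlonglongrightarrow> \<theta> \<Longrightarrow> (\<lambda>n. dir (f n)) \<longlonglongrightarrow> dir \<theta>"
  by (rule vec_tendstoI, rule forall_2[THEN iffD2, rule_format])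
     (auto simp: dir_def intro!: tendsto_intros)

lemma P_kernel_eq: "P_kernel \<theta> = (\<lambda>x. dirac_sum {1, -1 :: real} (\<lambda>_. 1/2) (\<lambda>s. x + s *\<^sub>R dir \<theta>))"
  by (rule ext) (simp add: P_kernel_def dir_def)

lemma mu_eq: "mu m = dirac_sum {1..m} (\<lambda>_. 1 / real m) site"
  by (simp add: mu_def site_def[abs_def])

lemma mu_in_prob_algebra: "1 \<le> m \<Longrightarrow> mu m \<in> space (prob_algebra borel)"
  unfolding mu_eq by (rule dirac_sum_in_prob_algebra) auto

lemma measurable_P_kernel: "P_kernel \<theta> \<in> borel \<rightarrow>\<^sub>M prob_algebra borel"
  unfolding P_kernel_eq by (rule measurable_dirac_sum) auto

lemma kernel_image_P_kernel:
  "kernel_image (mu m) (P_kernel \<theta>)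
    = dirac_sum ({1..m} \<times> {1, -1}) (\<lambda>(i, s). 1 / real m * (1/2)) (\<lambda>(i, s). site i + s *\<^sub>R dir \<theta>)"
  unfolding mu_eq P_kernel_eq by (rule kernel_image_dirac_sum) auto

lemma kernel_coupling_P_kernel:
  "kernel_coupling (mu m) (P_kernel \<theta>)
    = dirac_sum ({1..m} \<times> {1, -1}) (\<lambda>(i, s). 1 / real m * (1/2)) (\<lambda>(i, s). (site i, site i + s *\<^sub>R dir \<theta>))"
  unfolding mu_eq P_kernel_eq by (rule kernel_coupling_dirac_sum) auto

lemma P_kernel_martingale_coupling:
  assumes "1 \<le> m"
  shows "kernel_coupling (mu m) (P_kernel \<theta>)
    \<in> martingale_couplings (mu m) (kernel_image (mu m) (P_kernel \<theta>))"
  unfolding mu_eq P_kernel_eq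
  by (rule dirac_sum_martingale_coupling) (use assms in \<open>auto simp: scaleR_add_right scaleR_add_left[symmetric]\<close>)

lemma transport_cost_P_kernel:
  assumes "1 \<le> m"
  shows "transport_cost dist_cost (kernel_coupling (mu m) (P_kernel \<theta>)) = 1"
  unfolding kernel_coupling_P_kernel using assms
  by (subst transport_cost_dist_dirac_sum) (auto simp: split_def sum.cartesian_product' one_ereal_def)

text \<open>
  Measured perpendicularly to the direction \<open>dir \<theta>\<close> of the splitting, \<open>\<mu>\<close> and \<open>\<mu> P\<^sub>\<theta>\<close> have the same
  distribution, so a martingale coupling moves mass only parallel to \<open>dir \<theta>\<close>. If \<open>sin \<theta> \<noteq> 0\<close>, the lines
  of that direction through the different sites are disjoint. Hence the mass at a site reaches only the
  two atoms that were split off from it, and the barycentre forces equal weights. For \<open>\<theta> = 0\<close> all these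
  lines coincide with the axis and the rigidity is lost.
\<close>
lemma martingale_coupling_P_kernel_unique:
  assumes m: "1 \<le> m" and \<theta>: "sin \<theta> \<noteq> 0"
    and \<pi>: "\<pi> \<in> martingale_couplings (mu m) (kernel_image (mu m) (P_kernel \<theta>))"
  shows "\<pi> = kernel_coupling (mu m) (P_kernel \<theta>)"
proof -
  obtain K where K: "K \<in> borel \<rightarrow>\<^sub>M prob_algebra borel" and \<pi>K: "\<pi> = kernel_coupling (mu m) K"
    and AE_mean: "AE x in mu m. has_bochner_integral (K x) (\<lambda>y. y) x"
    using \<pi> unfolding martingale_couplings_def is_disintegration_def by blast
  have mean: "has_bochner_integral (K (site i)) (\<lambda>y. y) (site i)" if "i \<in> {1..m}" for i
    by (rule AE_dirac_sumD[OF _ _ AE_mean[unfolded mu_eq] that]) (use m in auto)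
  have image: "kernel_image (mu m) K = kernel_image (mu m) (P_kernel \<theta>)"
    using \<pi> kernel_image_eq_snd_marginal[OF mu_in_prob_algebra[OF m] K]
    by (simp add: martingale_couplings_def couplings_def \<pi>K)
  \<comment> \<open>A normal vector to \<open>dir \<theta>\<close>.\<close>
  define u :: "real^2" where "u = vector [sin \<theta>, - cos \<theta>]"
  have du: "dir \<theta> \<bullet> u = 0" and su: "site i \<bullet> u = real i * sin \<theta>" for i
    by (simp_all add: inner_vec2 dir_def u_def site_def)
  have eq: "K (site i) = P_kernel \<theta> (site i)" if i: "i \<in> {1..m}" for i
    unfolding P_kernel_eq
  proof (rule symmetric_two_point_measure)
    show "K (site i) \<in> space (prob_algebra borel)"
      using measurable_space[OF K] by simp
    show "dir \<theta> \<noteq> 0"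
      using norm_dir[of \<theta>] by (metis norm_zero zero_neq_one)
    show "has_bochner_integral (K (site i)) (\<lambda>y. y) (site i)"
      by (rule mean[OF i])
    have "AE y in K (site i). y \<in> (\<lambda>(i, s). site i + s *\<^sub>R dir \<theta>) ` ({1..m} \<times> {1, -1})
        \<and> y \<bullet> u = site i \<bullet> u"
    proof (rule martingale_kernel_preserves_component[where I="{1..m}" and w="\<lambda>_. 1 / real m"
          and v="\<lambda>(i, s). 1 / real m * (1/2)"])
      show "kernel_image (dirac_sum {1..m} (\<lambda>_. 1 / real m) site) K
          = dirac_sum ({1..m} \<times> {1, -1}) (\<lambda>(i, s). 1 / real m * (1/2)) (\<lambda>(i, s). site i + s *\<^sub>R dir \<theta>)"
        using image unfolding kernel_image_P_kernel unfolding mu_eq .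
      show "(\<Sum>j\<in>{1..m} \<times> {1, -1}. (case j of (i, s) \<Rightarrow> 1 / real m * (1/2)) *
          ((case j of (i, s) \<Rightarrow> site i + s *\<^sub>R dir \<theta>) \<bullet> u)\<^sup>2) = (\<Sum>i\<in>{1..m}. 1 / real m * (site i \<bullet> u)\<^sup>2)"
        by (simp add: split_def sum.cartesian_product' inner_add_left du)
    qed (use i m K mean in auto)
    then show "AE y in K (site i). y = site i + dir \<theta> \<or> y = site i - dir \<theta>"
    proof eventually_elim
      case (elim y)
      then obtain k s where "y = site k + s *\<^sub>R dir \<theta>" "s = 1 \<or> s = -1"
        by auto
      moreover from this have "k = i"
        using elim \<theta> by (simp add: inner_add_left du su)
      ultimately show ?case by auto
    qed
  qed
  have "AE x in mu m. x \<in> site ` {1..m}"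
    unfolding mu_eq by (rule AE_dirac_sum_mem) simp
  then have "AE x in mu m. distr (K x) borel (\<lambda>y. (x, y)) = distr (P_kernel \<theta> x) borel (\<lambda>y. (x, y))"
    by eventually_elim (auto simp: eq)
  then show ?thesis
    unfolding \<pi>K kernel_coupling_def
    by (rule bind_cong_AE'[OF mu_in_prob_algebra[OF m] measurable_distr_Pair[OF K]
          measurable_distr_Pair[OF measurable_P_kernel]])
qed

section \<open>The three-point example\<close>

text \<open>
  The competitor of \<open>P\<^sub>0\<close>: the displacement \<open>x - (2, 0)\<close> from the middle site is multiplied by
  \<open>1\<close>, \<open>2\<close>, \<open>-2\<close> with probabilities \<open>1/2\<close>, \<open>3/8\<close>, \<open>1/8\<close>. The factors keep the middle site fixed and send the
  outer sites to themselves and to the extreme points \<open>0\<close> and \<open>4\<close>, as \<open>\<mu>\<^sub>3 P\<^sub>0\<close> requires; the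
  probabilities make the mean factor \<open>1\<close>. The moves are written \<open>x + s *\<^sub>R (x - site 2)\<close>, with \<open>s\<close> one less
  than the factor.
\<close>
definition dilation_kernel :: "real^2 \<Rightarrow> (real^2) measure"
  where "dilation_kernel x = dirac_sum {0, 1, -3 :: real}
    (\<lambda>s. if s = 0 then 1/2 else if s = 1 then 3/8 else 1/8) (\<lambda>s. x + s *\<^sub>R (x - site 2))"

lemma site_dilation: "site i + s *\<^sub>R (site i - site 2) = vector [real i + s * (real i - 2), 0]"
  by (simp add: vec_eq_iff forall_2 site_def)

lemma site_dir_0: "site i + s *\<^sub>R dir 0 = vector [real i + s, 0]"
  by (simp add: vec_eq_iff forall_2 site_def dir_def)

text \<open>
  Both sides have masses \<open>1/6, 1/6, 1/3, 1/6, 1/6\<close> at \<open>0, 1, 2, 3, 4\<close> on the axis.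
\<close>
lemma kernel_image_dilation_kernel: "kernel_image (mu 3) dilation_kernel = kernel_image (mu 3) (P_kernel 0)"
proof (rule measure_eqI)
  let ?w = "\<lambda>s :: real. if s = 0 then 1/2 else if s = 1 then 3/8 else 1/8 :: real"
  have dilation: "kernel_image (mu 3) dilation_kernel = dirac_sum ({1..3} \<times> {0, 1, -3 :: real})
      (\<lambda>(i, s). 1 / real 3 * ?w s) (\<lambda>(i, s). site i + s *\<^sub>R (site i - site 2))"
    unfolding mu_eq dilation_kernel_def[abs_def] by (rule kernel_image_dirac_sum) auto
  show "sets (kernel_image (mu 3) dilation_kernel) = sets (kernel_image (mu 3) (P_kernel 0))"
    by (simp add: dilation kernel_image_P_kernel)
  fix A assume "A \<in> sets (kernel_image (mu 3) dilation_kernel)"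
  then have A: "A \<in> sets borel" by (simp add: dilation)
  \<comment> \<open>Hides the set \<open>A\<close>, so that what remains is linear in the five values \<open>f 0, \<dots>, f 4\<close>.\<close>
  define f where "f x = (indicator A (vector [x, 0] :: real^2) :: real)" for x :: real
  have f: "indicator A (vector [x, 0] :: real^2) = ennreal (f x)" "0 \<le> f x" for x
    by (auto simp: f_def indicator_def)
  have I: "{1..3} = {1, 2, 3 :: nat}" by auto
  show "emeasure (kernel_image (mu 3) dilation_kernel) A = emeasure (kernel_image (mu 3) (P_kernel 0)) A"
    unfolding dilation kernel_image_P_kernel emeasure_dirac_sum[OF A] split_def site_dilation site_dir_0 I
    by (simp add: sum.cartesian_product' f ennreal_mult[symmetric] ennreal_plus[symmetric] del: ennreal_plus)
qed

lemma dilation_coupling: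
  shows "kernel_coupling (mu 3) dilation_kernel
      \<in> martingale_couplings (mu 3) (kernel_image (mu 3) (P_kernel 0))"
    and "transport_cost dist_cost (kernel_coupling (mu 3) dilation_kernel) = ereal (1/2)"
proof -
  let ?w = "\<lambda>s :: real. if s = 0 then 1/2 else if s = 1 then 3/8 else 1/8 :: real"
  have I: "{Suc 0..3} = {1, 2, 3}" by auto
  show "kernel_coupling (mu 3) dilation_kernel
      \<in> martingale_couplings (mu 3) (kernel_image (mu 3) (P_kernel 0))"
    unfolding kernel_image_dilation_kernel[symmetric] unfolding mu_eq dilation_kernel_def[abs_def]
    by (rule dirac_sum_martingale_coupling) (auto simp: vec_eq_iff field_simps)
  have "kernel_coupling (mu 3) dilation_kernel = dirac_sum ({1..3} \<times> {0, 1, -3 :: real})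
      (\<lambda>(i, s). 1 / real 3 * ?w s) (\<lambda>(i, s). (site i, site i + s *\<^sub>R (site i - site 2)))"
    unfolding mu_eq dilation_kernel_def[abs_def] by (rule kernel_coupling_dirac_sum) auto
  moreover have "norm (site 1 - site 2) = 1" "norm (site 3 - site 2) = 1"
    by (simp_all add: norm_eq_sqrt_inner inner_vec2 site_def)
  ultimately show "transport_cost dist_cost (kernel_coupling (mu 3) dilation_kernel) = ereal (1/2)"
    by (simp add: transport_cost_dist_dirac_sum split_def sum.cartesian_product' I)
qed

lemma angle_tendsto_0: "(\<lambda>n. pi / (2 * real n)) \<longlonglongrightarrow> 0"
  by real_asymp

lemma sin_angle_nonzero: "1 \<le> n \<Longrightarrow> sin (pi / (2 * real n)) \<noteq> 0"
  by (rule less_imp_neq[symmetric], rule sin_gt_zero) (auto simp: field_simps)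

lemma weakly_converges_P_kernel:
  assumes "1 \<le> m" and "f \<longlonglongrightarrow> \<theta>"
  shows "weakly_converges (\<lambda>n. kernel_coupling (mu m) (P_kernel (f n)))
    (kernel_coupling (mu m) (P_kernel \<theta>))"
  unfolding kernel_coupling_P_kernel
  by (rule weakly_converges_dirac_sum)
     (use assms in \<open>auto simp: split_def sum.cartesian_product' intro!: tendsto_intros tendsto_dir\<close>)

lemma W1_P_kernel_tendsto_0:
  assumes m: "1 \<le> m" and f: "f \<longlonglongrightarrow> \<theta>"
  shows "(\<lambda>n. W1 (kernel_image (mu m) (P_kernel (f n))) (kernel_image (mu m) (P_kernel \<theta>))) \<longlonglongrightarrow> 0"
proof (rule tendsto_sandwich[where f="\<lambda>_. 0" and h="\<lambda>n. ereal (norm (dir \<theta> - dir (f n)))"])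
  have "W1 (kernel_image (mu m) (P_kernel \<phi>)) (kernel_image (mu m) (P_kernel \<theta>))
      \<le> ereal (norm (dir \<theta> - dir \<phi>))" for \<phi>
  proof -
    have "norm (site i + s *\<^sub>R dir \<theta> - (site i + s *\<^sub>R dir \<phi>)) = norm (dir \<theta> - dir \<phi>)"
      if "s = 1 \<or> s = -1" for i s
      using that by (auto simp: norm_minus_commute)
    then have "(\<Sum>z\<in>{1..m} \<times> {1, -1}. (case z of (i, s) \<Rightarrow> 1 / real m * (1/2)) *
        norm ((case z of (i, s) \<Rightarrow> site i + s *\<^sub>R dir \<theta>) - (case z of (i, s) \<Rightarrow> site i + s *\<^sub>R dir \<phi>)))
      = norm (dir \<theta> - dir \<phi>)"
      using m by (simp add: split_def sum.cartesian_product')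
    moreover have "(\<Sum>z\<in>{1..m} \<times> {1, -1 :: real}. (case z of (i, s) \<Rightarrow> 1 / real m * (1/2))) = 1"
      using m by (simp add: split_def)
    ultimately show ?thesis
      unfolding kernel_image_P_kernel
      using W1_dirac_sum_le[of "{1..m} \<times> {1, -1 :: real}" "\<lambda>(i, s). 1 / real m * (1/2)"
          "\<lambda>(i, s). site i + s *\<^sub>R dir \<phi>" "\<lambda>(i, s). site i + s *\<^sub>R dir \<theta>"]
      by auto
  qed
  then show "\<forall>\<^sub>F n in sequentially. W1 (kernel_image (mu m) (P_kernel (f n))) (kernel_image (mu m) (P_kernel \<theta>))
      \<le> ereal (norm (dir \<theta> - dir (f n)))"
    by simp
  have "(\<lambda>n. norm (dir \<theta> - dir (f n))) \<longlonglongrightarrow> norm (dir \<theta> - dir \<theta>)"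
    by (intro tendsto_intros tendsto_dir f)
  then show "(\<lambda>n. ereal (norm (dir \<theta> - dir (f n)))) \<longlonglongrightarrow> 0"
    by (simp add: zero_ereal_def)
qed (simp_all add: W1_nonneg)

theorem proposition1p2:
  shows
    "((\<lambda>n. W1 (nu 3 n) (kernel_image (mu 3) (P_kernel 0))) \<longlonglongrightarrow> 0) \<and>
     ((\<forall>n\<ge>1. MOT_minimizer dist_cost (mu 3) (nu 3 n)
                (kernel_coupling (mu 3) (P_kernel (pi / (2 * real n))))) \<and>
      (\<exists>\<pi>. weakly_converges (\<lambda>n. kernel_coupling (mu 3) (P_kernel (pi / (2 * real n)))) \<pi> \<and>
           \<pi> \<in> couplings (mu 3) (kernel_image (mu 3) (P_kernel 0)) \<and>
           \<not> MOT_minimizer dist_cost (mu 3) (kernel_image (mu 3) (P_kernel 0)) \<pi>)) \<and>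
     (((\<lambda>n. MOT_value dist_cost (mu 3) (nu 3 n)) \<longlonglongrightarrow> 1) \<and>
      1 > MOT_value dist_cost (mu 3) (kernel_image (mu 3) (P_kernel 0))) \<and>
     (martingale_couplings (mu 3) (kernel_image (mu 3) (P_kernel 0))
        - {kernel_coupling (mu 3) (P_kernel 0)} \<noteq> {} \<and>
      (\<forall>\<pi> \<in> martingale_couplings (mu 3) (kernel_image (mu 3) (P_kernel 0))
               - {kernel_coupling (mu 3) (P_kernel 0)}.
         \<not> (\<exists>p. (\<forall>n\<ge>1. p n \<in> martingale_couplings (mu 3) (nu 3 n)) \<and>
                weakly_converges p \<pi>)))"
proof -
  let ?\<pi> = "\<lambda>n. kernel_coupling (mu 3) (P_kernel (pi / (2 * real n)))"
  let ?\<pi>\<^sub>0 = "kernel_coupling (mu 3) (P_kernel 0)"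
  let ?\<nu>\<^sub>0 = "kernel_image (mu 3) (P_kernel 0)"
  let ?\<pi>\<^sub>d = "kernel_coupling (mu 3) dilation_kernel"
  have single: "martingale_couplings (mu 3) (nu 3 n) = {?\<pi> n}" if "1 \<le> n" for n
    unfolding nu_def
    using martingale_coupling_P_kernel_unique[OF _ sin_angle_nonzero[OF that], of 3]
      P_kernel_martingale_coupling[of 3] by auto
  have cost: "transport_cost dist_cost (kernel_coupling (mu 3) (P_kernel \<theta>)) = 1" for \<theta>
    by (rule transport_cost_P_kernel) simp
  have conv: "weakly_converges ?\<pi> ?\<pi>\<^sub>0"
    by (rule weakly_converges_P_kernel[OF _ angle_tendsto_0]) simp
  have cheaper: "transport_cost dist_cost ?\<pi>\<^sub>d < transport_cost dist_cost ?\<pi>\<^sub>0"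
    unfolding cost dilation_coupling(2) by (simp add: one_ereal_def)
  have W: "(\<lambda>n. W1 (nu 3 n) ?\<nu>\<^sub>0) \<longlonglongrightarrow> 0"
    unfolding nu_def by (rule W1_P_kernel_tendsto_0[OF _ angle_tendsto_0]) simp
  have minimizer: "MOT_minimizer dist_cost (mu 3) (nu 3 n) (?\<pi> n)" if "1 \<le> n" for n
    by (simp add: MOT_minimizer_def single[OF that])
  have coupling: "?\<pi>\<^sub>0 \<in> couplings (mu 3) ?\<nu>\<^sub>0"
    using P_kernel_martingale_coupling[of 3 0] by (simp add: martingale_couplings_def)
  have not_minimizer: "\<not> MOT_minimizer dist_cost (mu 3) ?\<nu>\<^sub>0 ?\<pi>\<^sub>0"
    using dilation_coupling(1) cheaper by (auto simp: MOT_minimizer_def not_le)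
  have "MOT_value dist_cost (mu 3) (nu 3 n) = 1" if "1 \<le> n" for n
    by (simp add: MOT_value_def single[OF that] cost)
  then have value_tendsto: "(\<lambda>n. MOT_value dist_cost (mu 3) (nu 3 n)) \<longlonglongrightarrow> 1"
    by (intro tendsto_eventually eventually_mono[OF eventually_ge_at_top[of 1]])
  have "MOT_value dist_cost (mu 3) ?\<nu>\<^sub>0 \<le> transport_cost dist_cost ?\<pi>\<^sub>d"
    unfolding MOT_value_def by (rule INF_lower[OF dilation_coupling(1)])
  then have value_less: "MOT_value dist_cost (mu 3) ?\<nu>\<^sub>0 < 1"
    using cheaper unfolding cost by (rule le_less_trans)
  have other: "?\<pi>\<^sub>d \<in> martingale_couplings (mu 3) ?\<nu>\<^sub>0 - {?\<pi>\<^sub>0}"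
    using dilation_coupling(1) cheaper by auto
  have not_limit: "\<pi> = ?\<pi>\<^sub>0"
    if "\<forall>n\<ge>1. p n \<in> martingale_couplings (mu 3) (nu 3 n)" "weakly_converges p \<pi>" for p \<pi>
  proof (rule weakly_converges_unique[OF that(2) conv])
    show "\<forall>\<^sub>F n in sequentially. p n = ?\<pi> n"
      by (intro eventually_mono[OF eventually_ge_at_top[of 1]]) (use that(1) single in auto)
  qed
  show ?thesis
    using W minimizer conv coupling not_minimizer value_tendsto value_less other not_limit by blast
qed

end
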